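(* Let $t\ge 3$ be an odd integer, let $d$ be a positive integer, and let $S=(d,d,d,\ldots)$. Then $$\chi_S(G_t)\le \begin{cases} 1+d(d+1), & \text{if } d\le \frac{t+1}{2},\\[2pt] td+\frac{1}{4}\left(-t^2+2t+7\right), & \text{if } d\ge \frac{t+1}{2}.\end{cases}$$
   Context: For an odd integer $t\ge 3$, $G_t$ denotes the integer distance graph $G(\mathbb{Z},\{2,t\})$: its vertex set is $\mathbb{Z}$, and distinct $i,j\in\mathbb{Z}$ are adjacent if and only if $|i-j|\in\{2,t\}$. For a graph $G$ and a non-decreasing sequence $S=(a_1,a_2,\ldots)$ of positive integers, an $S$-packing $k$-coloring of $G$ is a map $f:V(G)\to\{1,\ldots,k\}$ such that any two distinct vertices $u,v$ with $f(u)=f(v)=i$ satisfy $d_G(u,v)>a_i$, where $d_G$ is the shortest-path distance. The $S$-packing chromatic number $\chi_S(G)$ is the smallest $k$ for which $G$ has an $S$-packing $k$-coloring. *)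

theory Defs
  imports
    "Graph_Theory.Graph_Theory"
    "HOL-Library.Extended_Nat"
    "HOL-Library.Extended_Real"
    "HOL-Library.FuncSet"
begin

text \<open>
  An undirected simple graph is represented as a symmetric loop-free digraph without parallel
  arcs: each edge contributes both of its orientations. Finiteness is not required.
\<close>

definition distance_graph :: "int set \<Rightarrow> int pair_pre_digraph" where
  "distance_graph D =
     \<lparr> pverts = UNIV, parcs = {(i, j). i \<noteq> j \<and> \<bar>i - j\<bar> \<in> D} \<rparr>"

lemma wf_digraph_distance_graph: "wf_digraph (distance_graph D)"
  by unfold_locales (simp_all add: distance_graph_def)

lemma loopfree_digraph_distance_graph: "loopfree_digraph (distance_graph D)"
  by unfold_locales (auto simp: distance_graph_def)

lemma nomulti_digraph_distance_graph: "nomulti_digraph (distance_graph D)"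
  by unfold_locales (auto simp: distance_graph_def arc_to_ends_def)

lemma sym_digraph_distance_graph: "sym_digraph (distance_graph D)"
  by unfold_locales
    (auto simp: distance_graph_def symmetric_def abs_minus_commute intro: symI)

text \<open>
  With unit arc weights the cost of a walk is its number of arcs; the distance between vertices
  in different components is \<open>\<infinity>\<close>.
\<close>

definition graph_dist :: "('a, 'b) pre_digraph \<Rightarrow> 'a \<Rightarrow> 'a \<Rightarrow> ereal" where
  "graph_dist G u v = wf_digraph.\<mu> G (\<lambda>_. 1) u v"

text \<open>
  The sequence \<open>S = (a\<^sub>1, a\<^sub>2, \<dots>)\<close> is a function on \<open>nat\<close> with
  \<open>S i = a\<^sub>i\<close> for \<open>i \<ge> 1\<close>; the value \<open>S 0\<close> is never used.
\<close>

definition packing_coloring ::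
    "('a, 'b) pre_digraph \<Rightarrow> (nat \<Rightarrow> nat) \<Rightarrow> nat \<Rightarrow> ('a \<Rightarrow> nat) \<Rightarrow> bool" where
  "packing_coloring G S k f \<longleftrightarrow>
     f \<in> verts G \<rightarrow> {1..k} \<and>
     (\<forall>u\<in>verts G. \<forall>v\<in>verts G. \<forall>i\<in>{1..k}.
        u \<noteq> v \<and> f u = i \<and> f v = i \<longrightarrow> graph_dist G u v > ereal (real (S i)))"

text \<open>
  The infimum is attained if some coloring with finitely many colors exists, and is
  \<open>\<infinity>\<close> otherwise.
\<close>

definition packing_chromatic_number ::
    "('a, 'b) pre_digraph \<Rightarrow> (nat \<Rightarrow> nat) \<Rightarrow> enat" where
  "packing_chromatic_number G S = Inf {enat k | k. \<exists>f. packing_coloring G S k f}"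

end

theory Submission
  imports Defs
begin

text \<open>
  Two vertices of \<open>G\<^sub>t\<close> are at distance at most \<open>d\<close> iff their difference is \<open>2a + tb\<close> with
  \<open>\<bar>a\<bar> + \<bar>b\<bar> \<le> d\<close>. If \<open>P\<close> is the set of positive such differences, colouring from left to right
  greedily uses at most \<open>\<bar>P\<bar> + 1\<close> colours. The greedy rule starts at \<open>0\<close>, but it only looks back a
  bounded number of steps, so the colouring is eventually periodic and its period can be repeated
  over all of \<open>\<int>\<close>. It remains to count: there are \<open>2d(d+1) + 1\<close> pairs \<open>(a, b)\<close>; and if
  \<open>t = 2m + 1\<close> with \<open>d > m\<close>, the relation \<open>2a + tb = 2(a - t) + t(b + 2)\<close> allows one to take
  \<open>\<bar>a\<bar> \<le> m\<close>, apart from the two pairs \<open>\<plusminus>(m + 1, d - m - 1)\<close>.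
\<close>

section \<open>Greedy colouring of the integers\<close>

text \<open>Colours count from 0 here. The guard \<open>e \<le> n\<close> keeps \<open>n - e\<close>
  from being truncated, and \<open>0 < e\<close> makes the recursion terminate.\<close>

function greedy_color :: "nat set \<Rightarrow> nat \<Rightarrow> nat" where
  "greedy_color P n = (LEAST k. k \<notin> (\<lambda>e. greedy_color P (n - e)) ` {e \<in> P. 0 < e \<and> e \<le> n})"
  by auto
termination by (relation "measure snd") auto

declare greedy_color.simps [simp del]

text \<open>Pigeonhole: \<open>{..card X}\<close> has one element more than
  \<open>X\<close>.\<close>

lemma Least_notin_finite:
  fixes X :: "nat set"
  assumes "finite X"
  shows "(LEAST k. k \<notin> X) \<notin> X" and "(LEAST k. k \<notin> X) \<le> card X"
proof -
  have "\<not> {..card X} \<subseteq> X"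
    using card_mono[OF assms, of "{..card X}"] by auto
  then obtain k where k: "k \<le> card X" "k \<notin> X" by auto
  show "(LEAST k. k \<notin> X) \<notin> X" by (rule LeastI[of "\<lambda>k. k \<notin> X"]) (rule k(2))
  show "(LEAST k. k \<notin> X) \<le> card X" using Least_le[of "\<lambda>k. k \<notin> X", OF k(2)] k(1) by linarith
qed

lemma greedy_color_le:
  assumes "finite P"
  shows "greedy_color P n \<le> card P"
proof -
  let ?E = "{e \<in> P. 0 < e \<and> e \<le> n}"
  have "greedy_color P n \<le> card ((\<lambda>e. greedy_color P (n - e)) ` ?E)"
    using assms by (subst greedy_color.simps, intro Least_notin_finite(2)) auto
  also have "\<dots> \<le> card ?E" using assms by (intro card_image_le) auto
  also have "\<dots> \<le> card P" using assms by (intro card_mono) auto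
  finally show ?thesis .
qed

lemma greedy_color_neq:
  assumes "finite P" "e \<in> P" "0 < e"
  shows "greedy_color P (n + e) \<noteq> greedy_color P n"
proof -
  let ?X = "(\<lambda>i. greedy_color P (n + e - i)) ` {i \<in> P. 0 < i \<and> i \<le> n + e}"
  have "greedy_color P (n + e) \<notin> ?X"
    using assms by (subst greedy_color.simps, intro Least_notin_finite(1)) auto
  moreover have "greedy_color P (n + e - e) \<in> ?X" using assms by (intro imageI) auto
  ultimately show ?thesis by auto
qed

text \<open>If \<open>M\<close> bounds \<open>P\<close>, then from position \<open>M\<close> on the
  last \<open>M\<close> colours determine the next one. Colours are bounded, so some window of
  \<open>M\<close> colours occurs twice, and the colouring repeats from there.\<close>

lemma greedy_color_eventually_periodic:
  assumes "finite P"
  obtains n p where "p > 0" "\<And>j. greedy_color P (n + j + p) = greedy_color P (n + j)"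
proof -
  obtain M where M: "\<And>e. e \<in> P \<Longrightarrow> e \<le> M"
    using assms finite_nat_set_iff_bounded_le by auto
  \<comment> \<open>\<open>restrict\<close> places all windows in one finite space of extensional
    functions.\<close>
  define W where "W n = restrict (\<lambda>i. greedy_color P (n + i)) {..<M}" for n
  have "range W \<subseteq> {..<M} \<rightarrow>\<^sub>E {..card P}"
    using greedy_color_le[OF assms] by (auto simp: W_def split: if_splits)
  then have "finite (range W)"
    by (rule finite_subset) (auto intro: finite_PiE)
  then have "\<not> inj W" using finite_imageD infinite_UNIV_nat by blast
  then obtain x y where "x < y" and Wxy: "W x = W y"
    unfolding inj_def by (metis linorder_neqE_nat)
  have eq: "greedy_color P (y + j) = greedy_color P (x + j)" for j
  proof (induction j rule: less_induct)
    case (less j)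
    show ?case
    proof (cases "j < M")
      case True
      then show ?thesis using fun_cong[OF Wxy, of j] by (simp add: W_def)
    next
      case False
      \<comment> \<open>From offset \<open>M\<close> on the guard cuts off no element of
        \<open>P\<close>, so the recursions at \<open>x + j\<close> and \<open>y + j\<close> range
        over the same set.\<close>
      then have E: "{e \<in> P. 0 < e \<and> e \<le> z + j} = {e \<in> P. 0 < e}" for z
        using M by fastforce
      have "(\<lambda>e. greedy_color P (y + j - e)) ` {e \<in> P. 0 < e}
          = (\<lambda>e. greedy_color P (x + j - e)) ` {e \<in> P. 0 < e}"
      proof (rule image_cong[OF refl])
        fix e assume e: "e \<in> {e \<in> P. 0 < e}"
        then have "e \<le> j" using M[of e] False by auto
        then show "greedy_color P (y + j - e) = greedy_color P (x + j - e)"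
          using less.IH[of "j - e"] e by auto
      qed
      then show ?thesis by (simp add: greedy_color.simps[of P "_ + j"] E)
    qed
  qed
  show ?thesis
  proof (rule that[of "y - x" x])
    show "greedy_color P (x + j + (y - x)) = greedy_color P (x + j)" for j
      using eq[of j] \<open>x < y\<close> by (simp add: algebra_simps)
  qed (use \<open>x < y\<close> in simp)
qed

text \<open>The periodic tail depends only on residues modulo \<open>p\<close>, so it also colours
  the negative integers.\<close>

lemma int_coloring_forbidden_differences:
  fixes P :: "nat set"
  assumes "finite P"
  obtains f :: "int \<Rightarrow> nat"
    where "\<And>x. f x \<in> {1..card P + 1}"
      and "\<And>x e. e \<in> P \<Longrightarrow> 0 < e \<Longrightarrow> f (x + int e) \<noteq> f x"
proof -
  obtain n p where p: "p > 0"
    and per: "\<And>j. greedy_color P (n + j + p) = greedy_color P (n + j)"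
    using greedy_color_eventually_periodic[OF assms] by blast
  have per_mult: "greedy_color P (n + j + q * p) = greedy_color P (n + j)" for j q
  proof (induction q)
    case (Suc q)
    then show ?case using per[of "j + q * p"] by (simp add: algebra_simps)
  qed simp
  define c where "c j = greedy_color P (n + j)" for j
  have c_mod: "c (j mod p) = c j" for j
    using per_mult[of "j mod p" "j div p"] by (simp add: c_def add.assoc)
  \<comment> \<open>\<open>Suc\<close> moves the colours from \<open>{0..card P}\<close> to
    \<open>{1..card P + 1}\<close>.\<close>
  define f where "f x = Suc (c (nat (x mod int p)))" for x :: int
  have "f (x + int e) \<noteq> f x" if e: "e \<in> P" "0 < e" for x e
  proof -
    define r where "r = nat (x mod int p)"
    have r: "x mod int p = int r" using p by (simp add: r_def)
    \<comment> \<open>Only \<open>x\<close> is reduced modulo \<open>p\<close>: the greedy colours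
      compared are those at \<open>n + r + e\<close> and \<open>n + r\<close>, whose difference is
      still \<open>e\<close> even if \<open>e\<close> exceeds \<open>p\<close>.\<close>
    have "(x + int e) mod int p = (int r + int e) mod int p"
      using r by (metis mod_add_left_eq)
    also have "\<dots> = int ((r + e) mod p)" by (simp add: zmod_int)
    finally have "f (x + int e) = Suc (c (r + e))" by (simp add: f_def c_mod)
    moreover have "f x = Suc (c r)" by (simp add: f_def r)
    moreover have "c (r + e) \<noteq> c r"
      using greedy_color_neq[OF assms e, of "n + r"] by (simp add: c_def add.assoc)
    ultimately show ?thesis by simp
  qed
  moreover have "f x \<in> {1..card P + 1}" for x
    using greedy_color_le[OF assms] by (simp add: f_def c_def)
  ultimately show ?thesis using that by blast
qed

section \<open>Distances in the graph\<close>

text \<open>Each arc changes the position by 2 or \<open>t\<close> up to sign; \<open>a\<close> and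
  \<open>b\<close> are the signed counts of the two kinds.\<close>

lemma awalk_distance_graph_diff:
  assumes "pre_digraph.awalk (distance_graph {2, t}) u p v"
  shows "\<exists>a b. v - u = 2 * a + t * b \<and> \<bar>a\<bar> + \<bar>b\<bar> \<le> int (length p)"
proof -
  interpret wf_digraph "distance_graph {2, t}" by (rule wf_digraph_distance_graph)
  show ?thesis using assms
  proof (induction p arbitrary: u)
    case Nil
    then show ?case by (intro exI[of _ 0]) (auto simp: awalk_Nil_iff)
  next
    case (Cons e p)
    obtain x y where e: "e = (x, y)" by (cases e)
    from Cons.prems have arc: "e \<in> arcs (distance_graph {2, t})"
      and *: "x = u" "awalk y p v"
      by (simp_all add: awalk_Cons_iff e)
    obtain a b where ab: "v - y = 2 * a + t * b" "\<bar>a\<bar> + \<bar>b\<bar> \<le> int (length p)"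
      using Cons.IH[OF *(2)] by blast
    have "\<bar>x - y\<bar> = 2 \<or> \<bar>x - y\<bar> = t"
      using arc by (simp add: e distance_graph_def)
    then consider "y = u + 2" | "y = u - 2" | "y = u + t" | "y = u - t"
      using *(1) by linarith
    then show ?case
    proof cases
      case 1 then show ?thesis using ab by (intro exI[of _ "a + 1"] exI[of _ b]) auto
    next
      case 2 then show ?thesis using ab by (intro exI[of _ "a - 1"] exI[of _ b]) auto
    next
      case 3 then show ?thesis
        using ab by (intro exI[of _ a] exI[of _ "b + 1"]) (auto simp: algebra_simps)
    next
      case 4 then show ?thesis
        using ab by (intro exI[of _ a] exI[of _ "b - 1"]) (auto simp: algebra_simps)
    qed
  qed
qed

definition near_differences :: "int \<Rightarrow> nat \<Rightarrow> int set" where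
  "near_differences t d = {2 * a + t * b | a b. \<bar>a\<bar> + \<bar>b\<bar> \<le> int d}"

lemma graph_dist_distance_graph_gt:
  assumes "v - u \<notin> near_differences t d"
  shows "graph_dist (distance_graph {2, t}) u v > ereal (real d)"
proof -
  interpret wf_digraph "distance_graph {2, t}" by (rule wf_digraph_distance_graph)
  have len: "d + 1 \<le> length p" if "awalk u p v" for p
  proof (rule ccontr)
    assume "\<not> d + 1 \<le> length p"
    then show False
      using awalk_distance_graph_diff[OF that] assms by (force simp: near_differences_def)
  qed
  have cost: "awalk_cost (\<lambda>_. 1) p = real (length p)" for p :: "(int \<times> int) list"
    by (induction p) (auto simp: awalk_cost_def)
  \<comment> \<open>Bounding every walk strictly by \<open>d\<close> would only give a weak bound on
    the infimum; integrality of lengths supplies \<open>d + 1\<close>.\<close>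
  have "ereal (real (d + 1)) \<le> \<mu> (\<lambda>_. 1) u v"
    unfolding \<mu>_def
    by (intro INF_greatest) (auto simp: cost simp del: of_nat_add of_nat_Suc dest!: len)
  then show ?thesis
    unfolding graph_dist_def by (rule less_le_trans[rotated]) simp
qed

text \<open>The differences consist of 0, the elements of \<open>P\<close> and their negatives, so
  2|P| + 1 \<le> \<open>card T\<close>. Hence |P| \<le> \<open>N\<close>, and the greedy colouring
  needs at most \<open>N + 1\<close> colours.\<close>

lemma packing_chromatic_number_le_of_cover:
  fixes T :: "(int \<times> int) set"
  assumes "finite T" "near_differences t d \<subseteq> (\<lambda>(a, b). 2 * a + t * b) ` T"
    and "card T \<le> 2 * N + 1"
  shows "packing_chromatic_number (distance_graph {2, t}) (\<lambda>_. d) \<le> enat (N + 1)"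
proof -
  let ?D = "near_differences t d"
  define P where "P = {n. 0 < n \<and> int n \<in> ?D}"
  have finD: "finite ?D" using assms(1,2) finite_subset by blast
  have intP: "int ` P \<subseteq> ?D" by (auto simp: P_def)
  have neg: "- x \<in> ?D" if "x \<in> ?D" for x
  proof -
    from that obtain a b where "x = 2 * a + t * b" "\<bar>a\<bar> + \<bar>b\<bar> \<le> int d"
      by (auto simp: near_differences_def)
    then show ?thesis
      unfolding near_differences_def
      by (intro CollectI exI[of _ "-a"] exI[of _ "-b"]) auto
  qed
  have zero: "0 \<in> ?D"
    unfolding near_differences_def by (intro CollectI exI[of _ 0]) auto
  have finP: "finite P"
    using finite_subset[OF intP finD] by (rule finite_imageD) simp
  let ?A = "int ` P" and ?B = "(\<lambda>n. - int n) ` P"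
  have "card (insert 0 (?A \<union> ?B)) = Suc (card (?A \<union> ?B))"
    using finP by (intro card_insert_disjoint) (auto simp: P_def)
  also have "card (?A \<union> ?B) = card ?A + card ?B"
    using finP by (intro card_Un_disjoint) (auto simp: P_def)
  also have "\<dots> = 2 * card P"
    by (simp add: card_image inj_on_def)
  finally have "Suc (2 * card P) = card (insert 0 (?A \<union> ?B))" by simp
  also have "\<dots> \<le> card ?D"
    using intP neg zero finD by (intro card_mono) auto
  also have "\<dots> \<le> card ((\<lambda>(a, b). 2 * a + t * b) ` T)"
    using assms by (intro card_mono) auto
  also have "\<dots> \<le> card T" using assms(1) by (rule card_image_le)
  finally have "card P \<le> N" using assms(3) by simp
  obtain f :: "int \<Rightarrow> nat" where f: "\<And>x. f x \<in> {1..card P + 1}"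
    "\<And>x e. e \<in> P \<Longrightarrow> 0 < e \<Longrightarrow> f (x + int e) \<noteq> f x"
    using int_coloring_forbidden_differences[OF finP] by blast
  have pos: "v - u \<notin> ?D" if "f u = f v" "u < v" for u v
    using f(2)[of "nat (v - u)" u] that by (auto simp: P_def)
  have diff: "v - u \<notin> ?D" if "f u = f v" "u \<noteq> v" for u v
    using pos[of u v] pos[of v u] neg[of "v - u"] that by fastforce
  have "packing_coloring (distance_graph {2, t}) (\<lambda>_. d) (N + 1) f"
    unfolding packing_coloring_def
  proof (intro conjI ballI impI)
    show "f \<in> verts (distance_graph {2, t}) \<rightarrow> {1..N + 1}"
      using f(1) \<open>card P \<le> N\<close> by fastforce
  next
    fix u v i assume "u \<noteq> v \<and> f u = i \<and> f v = i"
    then show "graph_dist (distance_graph {2, t}) u v > ereal (real d)"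
      by (intro graph_dist_distance_graph_gt diff) auto
  qed
  then show ?thesis
    unfolding packing_chromatic_number_def by (intro Inf_lower) blast
qed

section \<open>Counting differences\<close>

text \<open>The lattice points of the l1 ball of radius \<open>d\<close> in the strip |a| \<le>
  \<open>m\<close>, given by columns so that their number is a sum over \<open>a\<close>.\<close>

definition truncated_diamond :: "nat \<Rightarrow> nat \<Rightarrow> (int \<times> int) set" where
  "truncated_diamond d m =
     (SIGMA a:{- int m..int m}. {- (int d - \<bar>a\<bar>)..int d - \<bar>a\<bar>})"

lemma mem_truncated_diamond:
  "(a, b) \<in> truncated_diamond d m \<longleftrightarrow> \<bar>a\<bar> \<le> int m \<and> \<bar>a\<bar> + \<bar>b\<bar> \<le> int d"
  by (auto simp: truncated_diamond_def)

lemma finite_truncated_diamond: "finite (truncated_diamond d m)"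
  by (auto simp: truncated_diamond_def)

lemma card_truncated_diamond:
  assumes "m \<le> d"
  shows "int (card (truncated_diamond d m))
    = (2 * int m + 1) * (2 * int d + 1) - 2 * int m * (int m + 1)"
proof -
  \<comment> \<open>Over the integers this identity needs no relation between \<open>m\<close> and
    \<open>d\<close>, so induction on \<open>m\<close> applies. Only equating column sizes with the
    summands uses \<open>m \<le> d\<close>.\<close>
  have sum: "(\<Sum>a\<in>{- int m..int m}. 2 * (int d - \<bar>a\<bar>) + 1)
      = (2 * int m + 1) * (2 * int d + 1) - 2 * int m * (int m + 1)"
  proof (induction m)
    case (Suc m)
    have "{- int (Suc m)..int (Suc m)}
        = insert (int m + 1) (insert (- (int m + 1)) {- int m..int m})" by auto
    then show ?case using Suc.IH by (simp add: algebra_simps)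
  qed simp
  have "int (card (truncated_diamond d m))
      = (\<Sum>a\<in>{- int m..int m}. int (card {- (int d - \<bar>a\<bar>)..int d - \<bar>a\<bar>}))"
    unfolding truncated_diamond_def by (subst card_SigmaI) auto
  also have "\<dots> = (\<Sum>a\<in>{- int m..int m}. 2 * (int d - \<bar>a\<bar>) + 1)"
    using assms by (intro sum.cong) auto
  finally show ?thesis using sum by simp
qed

text \<open>Shifting \<open>a\<close> towards 0 by \<open>t\<close> changes |b| by at most 2. If |a|
  \<ge> m + 2, then |a| drops by at least 3. If |a| = m + 1, it drops by 1, so |a| + |b| grows by at
  most 1 and can exceed \<open>d\<close> only at the two exceptional pairs.\<close>

lemma near_difference_reduce:
  fixes a b :: int
  assumes "t = 2 * int m + 1" "t \<ge> 3" "\<bar>a\<bar> + \<bar>b\<bar> \<le> int d"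
  shows "2 * a + t * b \<in> (\<lambda>(a, b). 2 * a + t * b) `
    (truncated_diamond d m \<union>
      {(int m + 1, int d - int m - 1), (- (int m + 1), - (int d - int m - 1))})"
    (is "_ \<in> ?F ` ?T")
  using assms(3)
proof (induction "nat \<bar>a\<bar>" arbitrary: a b rule: less_induct)
  case less
  show ?case
  proof (cases "(a, b) \<in> ?T")
    case True
    then show ?thesis by (rule rev_image_eqI) simp
  next
    case False
    then have out: "\<bar>a\<bar> > int m" "\<not> (a = int m + 1 \<and> b = int d - int m - 1)"
      "\<not> (a = - (int m + 1) \<and> b = - (int d - int m - 1))"
      using less.prems by (auto simp: mem_truncated_diamond)
    show ?thesis
    proof (cases "a > 0")
      case True
      have "2 * (a - t) + t * (b + 2) \<in> ?F ` ?T"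
        using less.prems out assms(1,2) True by (intro less.hyps) (linarith, smt (verit))
      then show ?thesis by (simp add: algebra_simps)
    next
      \<comment> \<open>Here \<open>a < 0\<close>, since |a| > m; this mirrors the previous
        case.\<close>
      case False
      have "2 * (a + t) + t * (b - 2) \<in> ?F ` ?T"
        using less.prems out assms(1,2) False by (intro less.hyps) (linarith, smt (verit))
      then show ?thesis by (simp add: algebra_simps)
    qed
  qed
qed

lemma packing_chromatic_number_le_diamond:
  "packing_chromatic_number (distance_graph {2, t}) (\<lambda>_. d) \<le> enat (d * (d + 1) + 1)"
proof (rule packing_chromatic_number_le_of_cover)
  show "finite (truncated_diamond d d)" by (rule finite_truncated_diamond)
  show "near_differences t d \<subseteq> (\<lambda>(a, b). 2 * a + t * b) ` truncated_diamond d d"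
    by (force simp: near_differences_def mem_truncated_diamond)
  have "int (card (truncated_diamond d d)) = int (2 * (d * (d + 1)) + 1)"
    by (simp add: card_truncated_diamond algebra_simps)
  then show "card (truncated_diamond d d) \<le> 2 * (d * (d + 1)) + 1"
    unfolding of_nat_eq_iff by simp
qed

text \<open>\<open>2 * N + 1\<close> is the size of the truncated diamond plus 2 for the exceptional
  pairs.\<close>

lemma packing_chromatic_number_le_truncated:
  assumes "t = 2 * int m + 1" "t \<ge> 3" "m < d"
    and N: "int N = t * int d + int m + 1 - int m * (int m + 1)"
  shows "packing_chromatic_number (distance_graph {2, t}) (\<lambda>_. d) \<le> enat (N + 1)"
proof (rule packing_chromatic_number_le_of_cover)
  let ?E = "{(int m + 1, int d - int m - 1), (- (int m + 1), - (int d - int m - 1))}"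
  let ?T = "truncated_diamond d m \<union> ?E"
  show "finite ?T" by (simp add: finite_truncated_diamond)
  show "near_differences t d \<subseteq> (\<lambda>(a, b). 2 * a + t * b) ` ?T"
    using near_difference_reduce[OF assms(1,2)] by (auto simp only: near_differences_def)
  have "card ?T \<le> card (truncated_diamond d m) + card ?E" by (rule card_Un_le)
  also have "card ?E \<le> 2" by (simp add: card_insert_if)
  finally have "int (card ?T) \<le> int (card (truncated_diamond d m)) + 2" by simp
  also have "\<dots> = 2 * int N + 1"
    using assms(3) by (simp add: card_truncated_diamond N assms(1) algebra_simps)
  finally show "card ?T \<le> 2 * N + 1" by linarith
qed

theorem theorem6:
  fixes t :: int and d :: nat and S :: "nat \<Rightarrow> nat"
  assumes "t \<ge> 3" and "odd t" and "d \<ge> 1"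
    and "S = (\<lambda>_. d)"
  shows "(real d \<le> (real_of_int t + 1) / 2 \<longrightarrow>
           ereal_of_enat (packing_chromatic_number (distance_graph {2, t}) S)
             \<le> ereal (1 + real d * (real d + 1))) \<and>
         (real d \<ge> (real_of_int t + 1) / 2 \<longrightarrow>
           ereal_of_enat (packing_chromatic_number (distance_graph {2, t}) S)
             \<le> ereal (real_of_int t * real d
                  + 1 / 4 * (- (real_of_int t)\<^sup>2 + 2 * real_of_int t + 7)))"
proof (intro conjI impI)
  let ?\<chi> = "packing_chromatic_number (distance_graph {2, t}) S"
  have "ereal_of_enat ?\<chi> \<le> ereal_of_enat (enat (d * (d + 1) + 1))"
    unfolding ereal_of_enat_le_iff assms(4) by (rule packing_chromatic_number_le_diamond)
  then show "ereal_of_enat ?\<chi> \<le> ereal (1 + real d * (real d + 1))"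
    by (simp add: algebra_simps)
next
  let ?\<chi> = "packing_chromatic_number (distance_graph {2, t}) S"
  assume large: "real d \<ge> (real_of_int t + 1) / 2"
  define m where "m = nat ((t - 1) div 2)"
  have t: "t = 2 * int m + 1" using assms(1,2) by (auto simp: m_def elim: oddE)
  then have "m < d" using large by simp
  define N where "N = nat (t * int d + int m + 1 - int m * (int m + 1))"
  \<comment> \<open>This keeps \<open>nat\<close> from truncating in \<open>N\<close>; it multiplies
    m \<le> t by m + 1 \<le> d.\<close>
  have "int m * (int m + 1) \<le> t * int d"
    using t \<open>m < d\<close> by (intro mult_mono) auto
  then have N: "int N = t * int d + int m + 1 - int m * (int m + 1)"
    by (simp add: N_def)
  have "ereal_of_enat ?\<chi> \<le> ereal_of_enat (enat (N + 1))"
    unfolding ereal_of_enat_le_iff assms(4)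
    by (rule packing_chromatic_number_le_truncated[OF t assms(1) \<open>m < d\<close> N])
  moreover have "real N = real_of_int (int N)" by simp
  \<comment> \<open>With m = (t - 1)/2, the term m + 2 - m(m + 1) becomes (-t^2 + 2t + 7)/4.\<close>
  then have "real (N + 1) = real_of_int t * real d
      + 1 / 4 * (- (real_of_int t)\<^sup>2 + 2 * real_of_int t + 7)"
    unfolding N by (simp add: t power2_eq_square algebra_simps)
  ultimately show "ereal_of_enat ?\<chi> \<le> ereal (real_of_int t * real d
      + 1 / 4 * (- (real_of_int t)\<^sup>2 + 2 * real_of_int t + 7))"
    by simp
qed

end
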